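(* Let $u$ be a real-valued locally semiconvex function on an open set $X\subset\mathbb{R}^n$, let $M\in\mathbb{R}$, and suppose that $\mathcal{K}(u,x)\geq M$ for almost every $x\in X$ (with respect to Lebesgue measure). Then $\mathcal{K}(u,x)\geq M$ for all $x\in X$.
   Context: A function $u$ is $\lambda$-semiconvex ($\lambda\ge0$) on a convex set if $u+\frac{\lambda}{2}|\cdot|^2$ is convex there; $u$ is locally semiconvex on $X$ if every $x\in X$ belongs to some ball $B\subset X$ on which $u$ is $\lambda$-semiconvex for some $\lambda=\lambda(x)\ge0$. If $u$ is differentiable at $x$, then $$\mathcal{K}(u,x)=\limsup_{\epsilon\to0}\,2\epsilon^{-2}\max_{h\in\mathbb{S}^{n-1}}\bigl(u(x+\epsilon h)-u(x)-\epsilon\langle Du(x),h\rangle\bigr),$$ and $\mathcal{K}(u,x)=+\infty$ if $u$ is not differentiable at $x$. *)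

theory Defs
  imports "HOL-Analysis.Analysis"
begin

definition semiconvex_on :: "real \<Rightarrow> 'a::euclidean_space set \<Rightarrow> ('a \<Rightarrow> real) \<Rightarrow> bool" where
  "semiconvex_on l S u \<longleftrightarrow> l \<ge> 0 \<and> convex_on S (\<lambda>x. u x + l / 2 * (norm x)\<^sup>2)"

(* The ball is open and contains x, but need not be centred at x. *)
definition locally_semiconvex_on :: "'a::euclidean_space set \<Rightarrow> ('a \<Rightarrow> real) \<Rightarrow> bool" where
  "locally_semiconvex_on X u \<longleftrightarrow>
     (\<forall>x\<in>X. \<exists>c r. x \<in> ball c r \<and> ball c r \<subseteq> X \<and> (\<exists>l. semiconvex_on l (ball c r) u))"

(* The derivative applied to h is the pairing of the gradient with h.  The maximum over
   the unit sphere is taken as a supremum in ereal; for u continuous on the sphere of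
   radius e about x it is attained.  Differentiability at x and the limsup depend only on
   the values of u near x, so values outside an open set containing x play no role. *)
definition Kurv :: "('a::euclidean_space \<Rightarrow> real) \<Rightarrow> 'a \<Rightarrow> ereal" where
  "Kurv u x =
     (if u differentiable (at x)
      then Limsup (at_right 0) (\<lambda>e::real. ereal (2 / e\<^sup>2) *
             (SUP h\<in>sphere 0 1. ereal (u (x + e *\<^sub>R h) - u x - e * frechet_derivative u (at x) h)))
      else \<infinity>)"

end

theory Submission
  imports Defs
begin

text \<open>
  Suppose that \<open>Kurv u a < M\<close>.  Near \<open>a\<close> the function \<open>u\<close> then lies below a paraboloid of
  opening \<open>C' < M\<close> that touches its graph at \<open>a\<close>.  Choose \<open>C\<close> with \<open>C' < C < M\<close>.  The paraboloid
  of opening \<open>C\<close> with the same slope touches \<open>u\<close> strictly at \<open>a\<close>, so every small tilt of it,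
  after a vertical shift, still touches \<open>u\<close> from above at some nearby point
  (\<open>touched_above_slopes_near\<close>).  At such a point the curvature is at most \<open>C < M\<close>
  (\<open>Kurv_le_if_touched_above\<close>), so the contradiction comes once the set of these touching points is
  known to have positive measure.

  This is the lemma of Jensen and Slodkowski (\<open>convex_touched_above_not_negligible\<close>), and it is where
  semiconvexity enters.  Adding a multiple of the squared norm makes \<open>u\<close> convex and shifts all
  openings by the same constant.  A convex function that is touched from above by a paraboloid
  is differentiable at the touching point, and its gradient there is both its supporting slope
  and the slope of the paraboloid.  Being squeezed from both sides makes the gradient locally Lipschitz
  on the set of touching points (\<open>convex_touched_above_Lipschitz\<close>).  Up to an affine change its
  values on this set include a whole ball of tilts, and a locally Lipschitz map takes negligible sets to negligible
  sets; hence the set of touching points is not negligible.  Alexandrov's theorem on second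
  derivatives is avoided, because at a touching point the paraboloid itself bounds the curvature.
\<close>

section \<open>Paraboloids touching from above\<close>

definition touched_above :: "real \<Rightarrow> 'a::euclidean_space set \<Rightarrow> ('a \<Rightarrow> real) \<Rightarrow> 'a \<Rightarrow> 'a \<Rightarrow> bool" where
  "touched_above C S f x p \<longleftrightarrow>
     (\<forall>z\<in>S. f z \<le> f x + p \<bullet> (z - x) + C / 2 * (norm (z - x))\<^sup>2)"

lemma touched_aboveD:
  "touched_above C S f x p \<Longrightarrow> z \<in> S \<Longrightarrow> f z \<le> f x + p \<bullet> (z - x) + C / 2 * (norm (z - x))\<^sup>2"
  by (auto simp: touched_above_def)

lemma touched_above_subset:
  "touched_above C S f x p \<Longrightarrow> T \<subseteq> S \<Longrightarrow> touched_above C T f x p"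
  by (auto simp: touched_above_def)

lemma norm_square_expand:
  fixes x z :: "'a::real_inner"
  shows "(norm z)\<^sup>2 = (norm x)\<^sup>2 + 2 * (x \<bullet> (z - x)) + (norm (z - x))\<^sup>2"
  by (simp add: power2_norm_eq_inner inner_diff inner_commute)

lemma touched_above_add_square:
  assumes "touched_above C S f x p"
  shows "touched_above (C + l) S (\<lambda>z. f z + l / 2 * (norm z)\<^sup>2) x (p + l *\<^sub>R x)"
  unfolding touched_above_def
proof
  fix z assume "z \<in> S"
  have "l / 2 * (norm z)\<^sup>2 = l / 2 * (norm x)\<^sup>2 + l * (x \<bullet> (z - x)) + l / 2 * (norm (z - x))\<^sup>2"
    unfolding norm_square_expand[of z x] by (simp add: algebra_simps)
  with touched_aboveD[OF assms \<open>z \<in> S\<close>]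
  show "f z + l / 2 * (norm z)\<^sup>2 \<le> f x + l / 2 * (norm x)\<^sup>2 + (p + l *\<^sub>R x) \<bullet> (z - x)
          + (C + l) / 2 * (norm (z - x))\<^sup>2"
    by (simp add: inner_add_left add_divide_distrib distrib_right)
qed

text \<open>
  Let \<open>w\<close> be a point slightly beyond \<open>x\<close> on the line from \<open>z\<close>.  Convexity on the segment from \<open>w\<close>
  to \<open>z\<close> bounds \<open>f z\<close> from below by \<open>f x\<close> and \<open>f w\<close>, and the paraboloid bounds \<open>f w\<close> from above.
  The quadratic term is of higher order in the distance from \<open>w\<close> to \<open>x\<close> and vanishes in the limit.
\<close>
lemma convex_touched_above_support:
  fixes f :: "'a::euclidean_space \<Rightarrow> real"
  assumes "open S" "convex_on S f" "x \<in> S" "z \<in> S"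
    and t: "touched_above C S f x p"
  shows "f x + p \<bullet> (z - x) \<le> f z"
proof -
  have "((\<lambda>t. x - t *\<^sub>R (z - x)) \<longlongrightarrow> x - 0 *\<^sub>R (z - x)) (at_right 0)"
    by (intro tendsto_intros)
  then have ev: "eventually (\<lambda>t. x - t *\<^sub>R (z - x) \<in> S) (at_right (0::real))"
    using \<open>open S\<close> \<open>x \<in> S\<close> by (auto dest: topological_tendstoD)
  have "eventually (\<lambda>t. f x + p \<bullet> (z - x) - f z \<le> t * (C / 2 * (norm (z - x))\<^sup>2)) (at_right 0)"
    using ev eventually_at_right_less
  proof eventually_elim
    case (elim t)
    let ?w = "x - t *\<^sub>R (z - x)"
    have "x = (1 / (1 + t)) *\<^sub>R ((1 + t) *\<^sub>R x)"
      using elim by simp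
    also have "(1 + t) *\<^sub>R x = ?w + t *\<^sub>R z"
      by (simp add: algebra_simps)
    finally have x: "(1 / (1 + t)) *\<^sub>R ?w + (t / (1 + t)) *\<^sub>R z = x"
      by (simp add: scaleR_add_right)
    have "1 - t / (1 + t) = 1 / (1 + t)"
      using elim by (simp add: field_simps)
    then have "f x \<le> (1 / (1 + t)) * f ?w + (t / (1 + t)) * f z"
      using elim \<open>z \<in> S\<close> convex_onD[OF \<open>convex_on S f\<close>, of "t / (1 + t)" ?w z] x
      by simp
    also have "\<dots> = (f ?w + t * f z) / (1 + t)"
      by (simp add: add_divide_distrib)
    finally have "(1 + t) * f x \<le> f ?w + t * f z"
      using elim by (simp add: pos_le_divide_eq mult.commute)
    also have "f ?w \<le> f x - t * (p \<bullet> (z - x)) + C / 2 * (t * norm (z - x))\<^sup>2"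
      using touched_aboveD[OF t, of ?w] elim by (simp add: power_mult_distrib)
    finally have "t * (f x + p \<bullet> (z - x) - f z) \<le> t * (t * (C / 2 * (norm (z - x))\<^sup>2))"
      by (simp add: algebra_simps power2_eq_square)
    then show ?case
      using elim by (simp only: mult_le_cancel_left_pos)
  qed
  moreover have "((\<lambda>t. t * (C / 2 * (norm (z - x))\<^sup>2)) \<longlongrightarrow> 0 * (C / 2 * (norm (z - x))\<^sup>2)) (at_right 0)"
    by (intro tendsto_intros)
  ultimately have "f x + p \<bullet> (z - x) - f z \<le> 0 * (C / 2 * (norm (z - x))\<^sup>2)"
    by (intro tendsto_lowerbound[OF _ _ trivial_limit_at_right_real])
  then show ?thesis by simp
qed

text \<open>
  The graph is squeezed between its supporting plane and the paraboloid, which differ only to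
  second order at \<open>x\<close>.
\<close>
lemma convex_touched_above_has_derivative:
  fixes f :: "'a::euclidean_space \<Rightarrow> real"
  assumes "open S" "convex_on S f" "x \<in> S"
    and t: "touched_above C S f x p"
  shows "(f has_derivative (\<lambda>h. p \<bullet> h)) (at x)"
  unfolding has_derivative_at_alt
proof (intro conjI allI impI)
  show "bounded_linear (\<lambda>h. p \<bullet> h)"
    by (rule bounded_linear_inner_right)
  fix e :: real assume "e > 0"
  obtain r where r: "r > 0" "ball x r \<subseteq> S"
    using \<open>open S\<close> \<open>x \<in> S\<close> openE by blast
  define d where "d = min r (e / (\<bar>C\<bar> + 1))"
  have "d > 0" using \<open>e > 0\<close> r by (simp add: d_def)
  moreover have "norm (f y - f x - p \<bullet> (y - x)) \<le> e * norm (y - x)" if "norm (y - x) < d" for y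
  proof -
    have "y \<in> S" using that r by (auto simp: d_def dist_norm norm_minus_commute)
    then have "norm (f y - f x - p \<bullet> (y - x)) \<le> C / 2 * (norm (y - x))\<^sup>2"
      using convex_touched_above_support[OF assms(1-3) _ t, of y] touched_aboveD[OF t, of y] by simp
    also have "\<dots> \<le> (\<bar>C\<bar> + 1) * norm (y - x) * norm (y - x)"
      unfolding power2_eq_square mult.assoc[symmetric] by (intro mult_right_mono) auto
    also have "(\<bar>C\<bar> + 1) * norm (y - x) \<le> e"
      using that by (simp add: d_def field_simps)
    finally show ?thesis by (simp add: mult_right_mono)
  qed
  ultimately show "\<exists>d>0. \<forall>y. norm (y - x) < d \<longrightarrow> norm (f y - f x - p \<bullet> (y - x)) \<le> e * norm (y - x)"
    by blast
qed

text \<open>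
  At any \<open>z\<close> the supporting plane at \<open>x\<close> lies below the paraboloid at \<open>y\<close>, while \<open>f y\<close> is at
  most the value at \<open>y\<close> of the paraboloid at \<open>x\<close>.  Together these bound \<open>(p - q) \<bullet> (z - y)\<close> by
  \<open>C / 2\<close> times the sum of the squared distances of \<open>y\<close> from \<open>x\<close> and \<open>z\<close>.  The best \<open>z\<close> lies in direction
  \<open>p - q\<close> from \<open>y\<close>, as far from \<open>y\<close> as \<open>x\<close> is; the ball in the hypothesis makes room for it.
\<close>
lemma convex_touched_above_Lipschitz:
  fixes f :: "'a::euclidean_space \<Rightarrow> real"
  assumes "open S" "convex_on S f" "x \<in> S"
    and x: "touched_above C S f x p" and y: "touched_above C S f y q"
    and sub: "cball y (norm (y - x)) \<subseteq> S" and "x \<noteq> y"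
  shows "norm (q - p) \<le> C * norm (y - x)"
proof (cases "p = q")
  case True
  have "0 \<le> C / 2 * (norm (y - x))\<^sup>2"
    using touched_aboveD[OF x, of y] convex_touched_above_support[OF assms(1-3) _ x, of y] sub
    by (auto simp: subset_iff)
  then have "0 \<le> C"
    using \<open>x \<noteq> y\<close> by (simp add: zero_le_mult_iff)
  with True show ?thesis by simp
next
  case False
  define d where "d = norm (y - x)"
  define z where "z = y + (d / norm (p - q)) *\<^sub>R (p - q)"
  have "d > 0" using \<open>x \<noteq> y\<close> by (simp add: d_def)
  have nz: "norm (z - y) = d"
    using False \<open>d > 0\<close> by (simp add: z_def)
  then have "z \<in> S" "y \<in> S"
    using sub by (auto simp: subset_iff d_def dist_norm norm_minus_commute)
  have "(p - q) \<bullet> (z - y) = d * norm (p - q)"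
    using False by (simp add: z_def power2_norm_eq_inner[symmetric] power2_eq_square)
  moreover have "f x + p \<bullet> (z - x) \<le> f y + q \<bullet> (z - y) + C / 2 * d\<^sup>2"
    using convex_touched_above_support[OF assms(1-3) \<open>z \<in> S\<close> x] touched_aboveD[OF y \<open>z \<in> S\<close>] nz
    by simp
  moreover have "f y \<le> f x + p \<bullet> (y - x) + C / 2 * d\<^sup>2"
    using touched_aboveD[OF x \<open>y \<in> S\<close>] by (simp add: d_def)
  ultimately have "d * norm (p - q) \<le> d * (C * d)"
    by (simp add: inner_diff algebra_simps power2_eq_square)
  then show ?thesis
    using \<open>d > 0\<close> by (simp add: d_def norm_minus_commute)
qed

section \<open>The set of touching points is not negligible\<close>

text \<open>
  Subtract from \<open>f\<close> the paraboloid of opening \<open>C\<close> centred at \<open>a\<close> with slope \<open>p + q\<close>.  On the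
  boundary sphere the gap between the two openings outweighs the tilt \<open>q\<close>, so the difference is
  below its value at \<open>a\<close> and its maximum is attained in the interior.  Rewriting the
  paraboloid about the maximum point \<open>x\<close> adds \<open>C *\<^sub>R (x - a)\<close> to its slope.
\<close>
lemma touched_above_slopes_near:
  fixes f :: "'a::euclidean_space \<Rightarrow> real"
  assumes cont: "continuous_on (cball a s) f" and "s > 0"
    and t: "touched_above C' (cball a s) f a p"
    and q: "norm q < (C - C') / 2 * s"
  shows "\<exists>x\<in>ball a s. touched_above C (cball a s) f x (p + q + C *\<^sub>R (x - a))"
proof -
  define g where "g = (\<lambda>z. f z - (p + q) \<bullet> (z - a) - C / 2 * (norm (z - a))\<^sup>2)"
  have "continuous_on (cball a s) g"
    unfolding g_def by (intro continuous_intros cont)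
  then obtain x where x: "x \<in> cball a s" "\<And>z. z \<in> cball a s \<Longrightarrow> g z \<le> g x"
    using continuous_attains_sup[of "cball a s" g] \<open>s > 0\<close> by auto
  have "norm (x - a) \<noteq> s"
  proof
    assume n: "norm (x - a) = s"
    have "f a \<le> g x"
      using x(2)[of a] \<open>s > 0\<close> by (simp add: g_def)
    moreover have "g x \<le> f a - q \<bullet> (x - a) - (C - C') / 2 * s * s"
      using touched_aboveD[OF t x(1)] n
      by (simp add: g_def inner_add_left field_simps power2_eq_square)
    moreover have "- (q \<bullet> (x - a)) \<le> norm q * s"
      using norm_cauchy_schwarz[of "-q" "x - a"] n by simp
    ultimately have "(C - C') / 2 * s * s \<le> norm q * s" by simp
    with q \<open>s > 0\<close> show False by (simp add: mult_le_cancel_right)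
  qed
  with x(1) have "x \<in> ball a s"
    by (auto simp: dist_norm norm_minus_commute)
  moreover have "touched_above C (cball a s) f x (p + q + C *\<^sub>R (x - a))"
    unfolding touched_above_def
  proof
    fix z assume "z \<in> cball a s"
    from x(2)[OF this] show "f z \<le> f x + (p + q + C *\<^sub>R (x - a)) \<bullet> (z - x) + C / 2 * (norm (z - x))\<^sup>2"
      unfolding g_def norm_square_expand[of "z - a" "x - a"]
      by (simp add: inner_add_left inner_diff_left inner_diff_right field_simps)
  qed
  ultimately show ?thesis by blast
qed

text \<open>
  The map \<open>G\<close> in the proof recovers the tilt \<open>q\<close> of the preceding lemma from the touching point.
  It is well defined because the slope at a touching point is the gradient of \<open>f\<close>.
\<close>
lemma convex_touched_above_not_negligible:
  fixes f :: "'a::euclidean_space \<Rightarrow> real"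
  assumes f: "convex_on (ball a r) f" and "0 < s" "s < r"
    and t: "touched_above C' (ball a r) f a p" and "C' < C"
  shows "\<not> negligible {x \<in> ball a s. \<exists>q. touched_above C (ball a s) f x q}"
    (is "\<not> negligible ?A")
proof
  assume A: "negligible ?A"
  define P where "P = (\<lambda>x. SOME q. touched_above C (ball a s) f x q)"
  define G where "G = (\<lambda>x. P x - p - C *\<^sub>R (x - a))"
  have sub: "cball a s \<subseteq> ball a r" using \<open>s < r\<close> by auto
  have fs: "convex_on (ball a s) f"
    using f by (rule convex_on_subset) (use \<open>s < r\<close> in auto)
  have P: "touched_above C (ball a s) f x (P x)" if "x \<in> ?A" for x
    using that unfolding P_def by (auto intro: someI)
  have P_eq: "P x = q" if "x \<in> ball a s" "touched_above C (ball a s) f x q" for x q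
  proof -
    have "touched_above C (ball a s) f x (P x)" using that P by blast
    with that have "(\<lambda>h. P x \<bullet> h) = (\<lambda>h. q \<bullet> h)"
      by (blast intro: has_derivative_unique convex_touched_above_has_derivative[OF open_ball fs])
    then have "P x \<bullet> h = q \<bullet> h" for h by metis
    then show ?thesis by (metis inner_commute vector_eq_ldot)
  qed
  have "negligible (G ` ?A)"
  proof (rule negligible_locally_Lipschitz_image[OF _ A])
    fix x assume x: "x \<in> ?A"
    \<comment> \<open>Half the distance to the boundary: the Lipschitz estimate between \<open>x\<close> and \<open>y\<close> uses points
      whose distance from \<open>x\<close> is up to twice that of \<open>y\<close>.\<close>
    define d where "d = (s - dist a x) / 2"
    have "norm (G y - G x) \<le> (C + \<bar>C\<bar>) * norm (y - x)" if y: "y \<in> ?A \<inter> ball x d" for y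
    proof (cases "x = y")
      case False
      have "cball y (norm (y - x)) \<subseteq> ball a s"
      proof
        fix z assume "z \<in> cball y (norm (y - x))"
        then show "z \<in> ball a s"
          using y dist_triangle[of a z x] dist_triangle[of x z y]
          by (auto simp: d_def dist_norm norm_minus_commute)
      qed
      with x y have "norm (P y - P x) \<le> C * norm (y - x)"
        by (intro convex_touched_above_Lipschitz[OF open_ball fs _ P P _ False]) auto
      moreover have "G y - G x = (P y - P x) - C *\<^sub>R (y - x)"
        by (simp add: G_def algebra_simps)
      ultimately show ?thesis
        using norm_triangle_ineq4[of "P y - P x" "C *\<^sub>R (y - x)"] by (simp add: distrib_right)
    qed simp
    moreover have "x \<in> ball x d" using x by (simp add: d_def)
    ultimately show "\<exists>T B. open T \<and> x \<in> T \<and> (\<forall>y\<in>?A \<inter> T. norm (G y - G x) \<le> B * norm (y - x))"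
      by blast
  qed simp
  moreover have "ball 0 ((C - C') / 2 * s) \<subseteq> G ` ?A"
  proof
    fix q :: 'a assume "q \<in> ball 0 ((C - C') / 2 * s)"
    moreover have "continuous_on (cball a s) f"
      using convex_on_continuous[OF open_ball f] sub by (rule continuous_on_subset)
    ultimately obtain x where x: "x \<in> ball a s"
      "touched_above C (cball a s) f x (p + q + C *\<^sub>R (x - a))"
      using touched_above_slopes_near[OF _ \<open>0 < s\<close> touched_above_subset[OF t sub], of q C] by auto
    then have x': "touched_above C (ball a s) f x (p + q + C *\<^sub>R (x - a))"
      using touched_above_subset ball_subset_cball by blast
    then have "G x = q" using P_eq[OF x(1) x'] by (simp add: G_def)
    then show "q \<in> G ` ?A" using x(1) x' by blast
  qed
  ultimately have "negligible (ball (0::'a) ((C - C') / 2 * s))"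
    using negligible_subset by blast
  moreover have "(C - C') / 2 * s > 0"
    using \<open>C' < C\<close> \<open>0 < s\<close> by simp
  ultimately show False
    using open_not_negligible[OF open_ball] by (metis ball_eq_empty not_le)
qed

section \<open>Curvature and paraboloids\<close>

lemma Kurv_le_if_touched_above:
  fixes u :: "'a::euclidean_space \<Rightarrow> real"
  assumes d: "(u has_derivative (\<lambda>h. p \<bullet> h)) (at x)"
    and "open S" "x \<in> S" and t: "touched_above C S u x p"
  shows "Kurv u x \<le> ereal C"
proof -
  obtain r where r: "r > 0" "ball x r \<subseteq> S"
    using \<open>open S\<close> \<open>x \<in> S\<close> openE by blast
  have fd: "frechet_derivative u (at x) = (\<lambda>h. p \<bullet> h)"
    using frechet_derivative_at[OF d] by simp
  have "eventually (\<lambda>e. ereal (2 / e\<^sup>2) *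
          (SUP h\<in>sphere 0 1. ereal (u (x + e *\<^sub>R h) - u x - e * frechet_derivative u (at x) h)) \<le> ereal C)
          (at_right 0)"
    using eventually_at_right_less eventually_at_right_real[OF r(1)]
  proof eventually_elim
    case (elim e)
    have "(SUP h\<in>sphere 0 1. ereal (u (x + e *\<^sub>R h) - u x - e * frechet_derivative u (at x) h))
            \<le> ereal (C / 2 * e\<^sup>2)"
    proof (rule SUP_least)
      fix h :: 'a assume h: "h \<in> sphere 0 1"
      then have "x + e *\<^sub>R h \<in> S"
        using elim r by (auto simp: subset_iff dist_norm)
      from touched_aboveD[OF t this]
      show "ereal (u (x + e *\<^sub>R h) - u x - e * frechet_derivative u (at x) h) \<le> ereal (C / 2 * e\<^sup>2)"
        using h elim by (simp add: fd)
    qed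
    then have "ereal (2 / e\<^sup>2) *
          (SUP h\<in>sphere 0 1. ereal (u (x + e *\<^sub>R h) - u x - e * frechet_derivative u (at x) h))
          \<le> ereal (2 / e\<^sup>2) * ereal (C / 2 * e\<^sup>2)"
      by (intro ereal_mult_left_mono) auto
    also have "\<dots> = ereal C" using elim by simp
    finally show ?case .
  qed
  then show ?thesis
    using d by (auto simp: Kurv_def differentiable_def intro: Limsup_bounded)
qed

text \<open>
  The strict bound on the limit superior holds for all small radii, and for each of them in all
  directions at once; in polar coordinates about \<open>x\<close> this is the touching condition with the
  gradient as slope.
\<close>
lemma touched_above_if_Kurv_less:
  fixes u :: "'a::euclidean_space \<Rightarrow> real"
  assumes "Kurv u x < ereal C"
  obtains r p where "r > 0" "touched_above C (ball x r) u x p"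
proof -
  let ?Q = "\<lambda>e. ereal (2 / e\<^sup>2) *
     (SUP h\<in>sphere 0 1. ereal (u (x + e *\<^sub>R h) - u x - e * frechet_derivative u (at x) h))"
  have diff: "u differentiable (at x)" and L: "Limsup (at_right 0) ?Q < ereal C"
    using assms by (auto simp: Kurv_def split: if_splits)
  have lin: "linear (frechet_derivative u (at x))"
    by (rule linear_frechet_derivative[OF diff])
  define p where "p = adjoint (frechet_derivative u (at x)) 1"
  have p: "frechet_derivative u (at x) h = p \<bullet> h" for h
    using adjoint_works[OF lin, of h 1] by (simp add: p_def inner_commute)
  obtain r where r: "r > 0" "\<And>e. 0 < e \<Longrightarrow> e < r \<Longrightarrow> ?Q e < ereal C"
    using Limsup_lessD[OF L] unfolding eventually_at_right_field by auto
  have "touched_above C (ball x r) u x p"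
    unfolding touched_above_def
  proof
    fix z assume z: "z \<in> ball x r"
    show "u z \<le> u x + p \<bullet> (z - x) + C / 2 * (norm (z - x))\<^sup>2"
    proof (cases "z = x")
      case False
      define e where "e = norm (z - x)"
      define h where "h = (1 / e) *\<^sub>R (z - x)"
      have e: "0 < e" "e < r" using z False by (auto simp: e_def dist_norm norm_minus_commute)
      have h: "h \<in> sphere 0 1" "z = x + e *\<^sub>R h"
        using e by (auto simp: h_def e_def)
      let ?s = "u z - u x - p \<bullet> (z - x)"
      have "ereal (2 / e\<^sup>2) * ereal ?s \<le> ?Q e"
        using h e by (intro ereal_mult_left_mono SUP_upper2[OF h(1)]) (auto simp: p)
      also have "\<dots> < ereal C" by (rule r(2)[OF e])
      finally have "2 / e\<^sup>2 * ?s < C" by simp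
      then have "?s \<le> C / 2 * e\<^sup>2"
        using e by (simp add: field_simps)
      then show ?thesis by (simp add: e_def)
    qed simp
  qed
  with r(1) that show thesis by blast
qed

section \<open>Curvature bounds from almost everywhere to everywhere\<close>

theorem theorem3p29:
  fixes u :: "real ^ 'n \<Rightarrow> real" and X :: "(real ^ 'n) set" and M :: real
  assumes "open X"
    and "locally_semiconvex_on X u"
    and "AE x in lebesgue. x \<in> X \<longrightarrow> Kurv u x \<ge> ereal M"
  shows "\<forall>x\<in>X. Kurv u x \<ge> ereal M"
proof (rule ballI, rule ccontr)
  fix a assume "a \<in> X" and "\<not> Kurv u a \<ge> ereal M"
  then obtain C' where C': "Kurv u a < ereal C'" "C' < M"
    using ereal_dense2[of "Kurv u a" "ereal M"] by (auto simp: not_le)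
  then obtain C where C: "C' < C" "C < M"
    using dense by blast
  obtain r0 p where r0: "r0 > 0" "touched_above C' (ball a r0) u a p"
    using touched_above_if_Kurv_less[OF C'(1)] .
  obtain c R l where B: "a \<in> ball c R" "ball c R \<subseteq> X" "semiconvex_on l (ball c R) u"
    using \<open>locally_semiconvex_on X u\<close> \<open>a \<in> X\<close> unfolding locally_semiconvex_on_def by blast
  define f where "f = (\<lambda>z. u z + l / 2 * (norm z)\<^sup>2)"
  have u: "u = (\<lambda>z. f z + (-l) / 2 * (norm z)\<^sup>2)"
    by (auto simp: f_def)
  obtain r1 where r1: "r1 > 0" "ball a r1 \<subseteq> ball c R"
    using B(1) openE[OF open_ball] by blast
  define r where "r = min r0 r1"
  define s where "s = r / 2"
  have r: "r > 0" "ball a r \<subseteq> ball c R" "ball a r \<subseteq> ball a r0"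
    using r0 r1 by (auto simp: r_def)
  then have s: "0 < s" "s < r" by (auto simp: s_def)
  have f: "convex_on (ball a r) f"
    using B(3) r(2) unfolding semiconvex_on_def f_def by (blast intro: convex_on_subset)
  have fs: "convex_on (ball a s) f"
    using f by (rule convex_on_subset) (use s in auto)
  let ?A = "{x \<in> ball a s. \<exists>q. touched_above (C + l) (ball a s) f x q}"
  have "touched_above (C' + l) (ball a r) f a (p + l *\<^sub>R a)"
    unfolding f_def by (intro touched_above_add_square touched_above_subset[OF r0(2) r(3)])
  with C(1) have "\<not> negligible ?A"
    by (intro convex_touched_above_not_negligible[OF f s]) auto
  moreover have "negligible ?A"
  proof -
    obtain N where N: "N \<in> null_sets lebesgue" "{x. \<not> (x \<in> X \<longrightarrow> Kurv u x \<ge> ereal M)} \<subseteq> N"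
      using assms(3) unfolding eventually_ae_filter by auto
    have "?A \<subseteq> {x. \<not> (x \<in> X \<longrightarrow> Kurv u x \<ge> ereal M)}"
    proof
      fix x assume "x \<in> ?A"
      then obtain q where x: "x \<in> ball a s" and q: "touched_above (C + l) (ball a s) f x q"
        by blast
      have "touched_above C (ball a s) u x (q - l *\<^sub>R x)"
        using touched_above_add_square[OF q, of "-l"] u by simp
      moreover have "(u has_derivative (\<lambda>h. (q - l *\<^sub>R x) \<bullet> h)) (at x)"
      proof -
        have "((\<lambda>z. f z - l / 2 * (z \<bullet> z)) has_derivative
                (\<lambda>h. q \<bullet> h - l / 2 * (x \<bullet> h + h \<bullet> x))) (at x)"
          by (intro derivative_intros convex_touched_above_has_derivative[OF open_ball fs x q])
        moreover have "(\<lambda>z. f z - l / 2 * (z \<bullet> z)) = u"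
          by (auto simp: f_def power2_norm_eq_inner)
        ultimately show ?thesis
          by (simp add: inner_diff_left inner_diff_right inner_commute)
      qed
      ultimately have "Kurv u x \<le> ereal C"
        using Kurv_le_if_touched_above[OF _ open_ball x] by blast
      also have "\<dots> < ereal M" using C(2) by simp
      finally have "\<not> Kurv u x \<ge> ereal M" by simp
      moreover have "ball a s \<subseteq> ball a r" using s by auto
      then have "x \<in> X" using x r(2) B(2) by blast
      ultimately show "x \<in> {x. \<not> (x \<in> X \<longrightarrow> Kurv u x \<ge> ereal M)}" by blast
    qed
    with N show ?thesis
      by (meson negligible_iff_null_sets negligible_subset subset_trans)
  qed
  ultimately show False by blast
qed

end
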